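(* Let $\mathbf{N}$ denote the set of positive integers and $\mathbf{Q}$ the set of rational numbers. Let $S = \mathcal{I} \cap \mathbf{Q}$, where $\mathcal{I} \subseteq \mathbf{R}$ is an interval (open, closed, or half-open) with nonempty interior. If $f:\mathbf{N} \rightarrow S$ is surjective, then for no positive integer $k$ is $f$ $k$-monotonic; that is, for every positive integer $k$ there do not exist subsets $X_1, \ldots, X_k \subseteq \mathbf{N}$ with $\mathbf{N} = X_1 \cup \cdots \cup X_k$ such that for each $i$ the restriction $f|X_i$ is monotonically increasing or monotonically decreasing.
   Context: A function $g: A \rightarrow B$ between ordered sets is monotonically increasing if $x \leq x'$ implies $g(x) \leq g(x')$, and monotonically decreasing if $x \leq x'$ implies $g(x) \geq g(x')$. The function $f$ is called $k$-monotonic if its domain is a union of $k$ subsets on each of which $f$ is monotonically increasing or monotonically decreasing. *)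

theory Defs
  imports "HOL-Analysis.Analysis"
begin

definition k_monotonic_on :: "nat \<Rightarrow> 'a::order set \<Rightarrow> ('a \<Rightarrow> 'b::order) \<Rightarrow> bool" where
  "k_monotonic_on k A f \<longleftrightarrow>
    (\<exists>X :: nat \<Rightarrow> 'a set. A = (\<Union>i\<in>{1..k}. X i) \<and>
      (\<forall>i\<in>{1..k}. mono_on (X i) f \<or> antimono_on (X i) f))"

end

theory Submission
  imports Defs
begin

text \<open>
  If \<open>f\<close> is monotone on a set \<open>X\<close> of naturals, then each point of \<open>f ` X\<close> has only finitely many
  points of \<open>f ` X\<close> on one of its sides, because each \<open>n \<in> X\<close> has only finitely many predecessors.
  Such an image is nowhere dense: a nonempty open set in its closure would contain three points of
  it, and infinitely many points of it would lie on each side of the middle one. Finite unions of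
  nowhere dense sets are nowhere dense, whereas the rationals of a nondegenerate interval are
  dense in it.
\<close>

definition nowhere_dense :: "'a::topological_space set \<Rightarrow> bool" where
  "nowhere_dense S \<longleftrightarrow> interior (closure S) = {}"

lemma nowhere_dense_UN:
  assumes "finite A" and "\<And>i. i \<in> A \<Longrightarrow> nowhere_dense (S i)"
  shows "nowhere_dense (\<Union>i\<in>A. S i)"
  using assms
  by (induction rule: finite_induct)
    (simp_all add: nowhere_dense_def interior_closed_Un_empty_interior)

lemma interior_subset_closure_Int_dense:
  assumes "closure D = UNIV"
  shows "interior S \<subseteq> closure (S \<inter> D)"
proof -
  have "interior S = interior S \<inter> closure D"
    using assms by simp
  also have "\<dots> \<subseteq> closure (interior S \<inter> D)"
    by (intro open_Int_closure_subset open_interior)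
  also have "\<dots> \<subseteq> closure (S \<inter> D)"
    by (intro closure_mono Int_mono interior_subset order_refl)
  finally show ?thesis .
qed

lemma interior_empty_if_nowhere_dense_Int_dense:
  assumes "nowhere_dense (S \<inter> D)" and "closure D = UNIV"
  shows "interior S = {}"
  using interior_maximal[OF interior_subset_closure_Int_dense[OF assms(2)] open_interior] assms(1)
  unfolding nowhere_dense_def by blast

lemma open_Int_interior_closure_empty_if_finite:
  fixes S U :: "'a::{t1_space, perfect_space} set"
  assumes "open U" and "finite (U \<inter> S)"
  shows "U \<inter> interior (closure S) = {}"
proof (rule equals0I)
  fix x
  assume "x \<in> U \<inter> interior (closure S)"
  then have "x islimpt U \<inter> interior (closure S)"
    using assms(1) by (intro open_imp_islimpt open_Int open_interior)
  moreover have "U \<inter> interior (closure S) \<subseteq> closure (U \<inter> S)"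
    using open_Int_closure_subset[OF assms(1), of S] interior_subset by blast
  moreover have "closure (U \<inter> S) = U \<inter> S"
    using assms(2) by (intro closure_closed finite_imp_closed)
  ultimately have "x islimpt U \<inter> S"
    by (simp add: islimpt_subset)
  with islimpt_finite[OF assms(2)] show False
    by contradiction
qed

lemma infinite_linorder_obtain_between:
  fixes S :: "'a::linorder set"
  assumes "infinite S"
  obtains x y z where "x \<in> S" "y \<in> S" "z \<in> S" "x < y" "y < z"
proof -
  obtain T where "T \<subseteq> S" "card T = 3"
    using infinite_arbitrarily_large[OF assms] by blast
  then obtain a b c where "a \<in> S" "b \<in> S" "c \<in> S" "a \<noteq> b" "b \<noteq> c" "a \<noteq> c"
    by (auto simp: card_3_iff)
  then show thesis
    using that by (metis linorder_neqE)
qed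

lemma nowhere_dense_if_finite_one_side:
  fixes S :: "'a::{linorder_topology, perfect_space} set"
  assumes one_side: "\<And>y. y \<in> S \<Longrightarrow> finite ({..<y} \<inter> S) \<or> finite ({y<..} \<inter> S)"
  shows "nowhere_dense S"
proof (rule ccontr)
  define U where "U = interior (closure S)"
  assume "\<not> nowhere_dense S"
  then have "U \<noteq> {}"
    by (simp add: nowhere_dense_def U_def)
  then have "infinite (U \<inter> S)"
    using open_Int_interior_closure_empty_if_finite[of U S] by (auto simp: U_def)
  then obtain x y z where "x \<in> U" "y \<in> S" "z \<in> U" "x < y" "y < z"
    by (elim infinite_linorder_obtain_between) blast
  then have "{..<y} \<inter> U \<noteq> {}" "{y<..} \<inter> U \<noteq> {}"
    by auto
  then show False
    using one_side[OF \<open>y \<in> S\<close>]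
      open_Int_interior_closure_empty_if_finite[OF open_lessThan, of y S]
      open_Int_interior_closure_empty_if_finite[OF open_greaterThan, of y S]
    unfolding U_def by blast
qed

lemma monotone_on_image_not_related_subset:
  fixes f :: "'a::linorder \<Rightarrow> 'b"
  assumes "monotone_on X (\<le>) R f" and "n \<in> X"
  shows "{z \<in> f ` X. \<not> R (f n) z} \<subseteq> f ` (X \<inter> {..<n})"
proof clarify
  fix m
  assume "m \<in> X" "\<not> R (f n) (f m)"
  then have "\<not> n \<le> m"
    using monotone_onD[OF assms, of m] by blast
  with \<open>m \<in> X\<close> show "f m \<in> f ` (X \<inter> {..<n})"
    by simp
qed

lemma nowhere_dense_monotone_image:
  fixes f :: "'a::linorder \<Rightarrow> 'b::{linorder_topology, perfect_space}"
  assumes "mono_on X f \<or> antimono_on X f"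
    and "\<And>n. n \<in> X \<Longrightarrow> finite (X \<inter> {..<n})"
  shows "nowhere_dense (f ` X)"
proof (rule nowhere_dense_if_finite_one_side)
  fix y
  assume "y \<in> f ` X"
  then obtain n where n: "n \<in> X" "y = f n"
    by blast
  then have finite_unrelated: "finite {z \<in> f ` X. \<not> R y z}" if "monotone_on X (\<le>) R f" for R
    using monotone_on_image_not_related_subset[OF that n(1)] assms(2) finite_subset by blast
  have "{z \<in> f ` X. \<not> y \<le> z} = {..<y} \<inter> f ` X" "{z \<in> f ` X. \<not> z \<le> y} = {y<..} \<inter> f ` X"
    by auto
  then show "finite ({..<y} \<inter> f ` X) \<or> finite ({y<..} \<inter> f ` X)"
    using assms(1) finite_unrelated[of "(\<le>)"] finite_unrelated[of "(\<ge>)"] by argo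
qed

lemma nowhere_dense_k_monotonic_image:
  fixes f :: "'a::linorder \<Rightarrow> 'b::{linorder_topology, perfect_space}"
  assumes "k_monotonic_on k A f"
    and "\<And>n. n \<in> A \<Longrightarrow> finite (A \<inter> {..<n})"
  shows "nowhere_dense (f ` A)"
proof -
  obtain X where A: "A = (\<Union>i\<in>{1..k}. X i)"
    and monotone: "\<And>i. i \<in> {1..k} \<Longrightarrow> mono_on (X i) f \<or> antimono_on (X i) f"
    using assms(1) unfolding k_monotonic_on_def by blast
  have "nowhere_dense (f ` X i)" if "i \<in> {1..k}" for i
  proof (rule nowhere_dense_monotone_image[OF monotone[OF that]])
    fix n
    assume "n \<in> X i"
    then have "n \<in> A" "X i \<inter> {..<n} \<subseteq> A \<inter> {..<n}"
      using A that by auto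
    then show "finite (X i \<inter> {..<n})"
      using assms(2) finite_subset by blast
  qed
  then have "nowhere_dense (\<Union>i\<in>{1..k}. f ` X i)"
    by (intro nowhere_dense_UN finite_atLeastAtMost)
  then show ?thesis
    by (simp add: A image_UN)
qed

theorem theorem3:
  fixes I S :: "real set" and f :: "nat \<Rightarrow> real"
  assumes "is_interval I" and "interior I \<noteq> {}"
    and "S = I \<inter> \<rat>"
    and "f ` {1..} = S"
  shows "\<forall>k\<ge>1. \<not> k_monotonic_on k {1..} f"
proof (intro allI impI notI)
  fix k :: nat
  assume "k_monotonic_on k {1..} f"
  then have "nowhere_dense (f ` {1..})"
    by (rule nowhere_dense_k_monotonic_image) simp
  then have "nowhere_dense (I \<inter> \<rat>)"
    using assms(3,4) by simp
  then have "interior I = {}"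
    using Rats_closure_real by (rule interior_empty_if_nowhere_dense_Int_dense)
  with assms(2) show False
    by contradiction
qed

end
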